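(* Let $\mathcal{A}=\{A_1,A_2,A_3\}\subset H(\mathbb{R}^2)$ be the boundary with $A_i=\{a_i,b_i\}$ described in the context, let $t_0=\frac{\sqrt5}{4}-\frac12\sqrt{\sqrt5-\frac74}$, $\omega_0=\sqrt{1+t_0^2-t_0}$, $K_0=T_{ab}(t_0)$, and $d=\bigl(\omega_0,\omega_0,\sqrt{1+t_0^2+t_0}\bigr)$. Then: (1) The compact $K_0$ is a solution to the Fermat--Steiner problem for $\mathcal{A}$ (i.e. $K_0\in\Sigma(\mathcal{A})$), the Hausdorff distances from $K_0$ to $A_1$ and $A_2$ are equal to $\omega_0$, and the Hausdorff distance from $K_0$ to $A_3$ is equal to $\sqrt{1+t_0^2+t_0}$, i.e. $K_0\in\Sigma_d(\mathcal{A})$; in particular, $$S_{\mathcal{A}}(K_0)=2\omega_0+\sqrt{1+t_0^2+t_0}=\sqrt{\tfrac{35}{8}+\tfrac38\sqrt{-47+80\sqrt5}}=2.94645\ldots<3.$$ (2) $K_0$ is the unique minimal Steiner compact in $\Sigma_d(\mathcal{A})$. (3) The maximal Steiner compact in $\Sigma_d(\mathcal{A})$ is equal to $K_d(\mathcal{A})$. (4) The set $\Sigma(\mathcal{A})$ of all Steiner compacts is partitioned into exactly three classes $\Sigma_g(\mathcal{A})$: the corresponding vectors $g$ are $d$ and the vectors obtained from $d$ by cyclic permutations of its components, and the two classes other than $\Sigma_d(\mathcal{A})$ are obtained from $\Sigma_d(\mathcal{A})$ by rotating the plane by the angles $2\pi/3$ and $4\pi/3$ around the point $o$.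
   Context: $H(\mathbb{R}^2)$ denotes the set of all nonempty compact subsets of the Euclidean plane endowed with the Hausdorff distance $d_H$. For $A\subset\mathbb{R}^2$ and $r\ge0$, $B_r(A)$ is the set of points at distance at most $r$ from $A$ (a closed disc if $A$ is a point), and $\partial B_r(a)$ is the circle of radius $r$ centered at the point $a$. For $\mathcal{A}=\{A_1,A_2,A_3\}\subset H(\mathbb{R}^2)$ and $K\in H(\mathbb{R}^2)$ put $S_{\mathcal{A}}(K)=\sum_{i} d_H(K,A_i)$. $\Sigma(\mathcal{A})$ is the set of all $K\in H(\mathbb{R}^2)$ at which $S_{\mathcal{A}}$ attains its minimum over $H(\mathbb{R}^2)$; its elements are called Steiner compacts (solutions to the Fermat--Steiner problem for $\mathcal{A}$). For a vector $g=(g_1,g_2,g_3)$, $\Sigma_g(\mathcal{A})=\{K\in\Sigma(\mathcal{A}):d_H(K,A_i)=g_i\text{ for all }i\}$; the classes considered are the nonempty ones. A minimal (maximal) Steiner compact in $\Sigma_g(\mathcal{A})$ is a minimal (maximal) element of $\Sigma_g(\mathcal{A})$ with respect to inclusion. $K_g(\mathcal{A})=\bigcap_{i}B_{g_i}(A_i)$. The boundary: $a_1,a_2,a_3$ are the vertices of a regular triangle inscribed in the unit circle centered at the origin $o$, and $b_i$ is obtained from $a_i$ by the rotation about $o$ by the angle $\pi/3$, with the labelling and orientation such that the points occur along the circle in the cyclic order $a_1,b_1,a_2,b_2,a_3,b_3$. $A_i=\{a_i,b_i\}$ for $i=1,2,3$. For $\omega\in(\sqrt3/2,1)$ let $k_a$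 and $k_b$ be the points closest to $o$ in the sets $\partial B_\omega(a_1)\cap\partial B_\omega(a_2)$ and $\partial B_\omega(b_1)\cap\partial B_\omega(b_2)$, respectively; they belong to the segments $[o,b_1]$ and $[o,a_2]$, respectively. Put $t=|ok_a|=|ok_b|$; then $t\in(0,1/2)$ and $\omega=\sqrt{1+t^2-t}$, so that one can use $t$ as the parameter and write $k_a(t),k_b(t)$. Put $T_{ab}(t)=\{k_a(t),k_b(t)\}$ for $t\in(0,1/2)$. (Thus $k_a(t)$ is the point of $[o,b_1]$ at distance $t$ from $o$, and $k_b(t)$ is the point of $[o,a_2]$ at distance $t$ from $o$.) *)

theory Defs
  imports "HOL-Analysis.Analysis" "HOL-Library.Disjoint_Sets"
begin

text \<open>The Euclidean plane is the type \<^typ>\<open>complex\<close>, with \<open>o = 0\<close>. Triples are indexed by the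
  three-element type \<open>3\<close>, whose elements are \<open>1\<close>, \<open>2\<close> and \<open>3 = 0\<close>.\<close>

definition compacts :: "'a::metric_space set set" where
  "compacts = {K. compact K \<and> K \<noteq> {}}"

text \<open>Meaningful for nonempty bounded sets, which is the only case where it is used.\<close>

definition hausdorff_dist :: "'a::metric_space set \<Rightarrow> 'a set \<Rightarrow> real" where
  "hausdorff_dist A B = max (SUP x\<in>A. infdist x B) (SUP y\<in>B. infdist y A)"

definition closed_nbhd :: "real \<Rightarrow> 'a::metric_space set \<Rightarrow> 'a set" where
  "closed_nbhd r A = {x. infdist x A \<le> r}"

definition steiner_sum :: "(3 \<Rightarrow> complex set) \<Rightarrow> complex set \<Rightarrow> real" where
  "steiner_sum A K = (\<Sum>i\<in>UNIV. hausdorff_dist K (A i))"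

definition steiner_compacts :: "(3 \<Rightarrow> complex set) \<Rightarrow> complex set set" where
  "steiner_compacts A =
     {K \<in> compacts. \<forall>L\<in>compacts. steiner_sum A K \<le> steiner_sum A L}"

definition steiner_class :: "(3 \<Rightarrow> complex set) \<Rightarrow> real ^ 3 \<Rightarrow> complex set set" where
  "steiner_class A g = {K \<in> steiner_compacts A. \<forall>i. hausdorff_dist K (A i) = g $ i}"

definition steiner_classes :: "(3 \<Rightarrow> complex set) \<Rightarrow> complex set set set" where
  "steiner_classes A = {steiner_class A g | g. steiner_class A g \<noteq> {}}"

definition minimal_in :: "'a set set \<Rightarrow> 'a set \<Rightarrow> bool" where
  "minimal_in F K \<longleftrightarrow> K \<in> F \<and> (\<forall>L\<in>F. L \<subseteq> K \<longrightarrow> L = K)"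

definition maximal_in :: "'a set set \<Rightarrow> 'a set \<Rightarrow> bool" where
  "maximal_in F K \<longleftrightarrow> K \<in> F \<and> (\<forall>L\<in>F. K \<subseteq> L \<longrightarrow> L = K)"

definition K_set :: "(3 \<Rightarrow> complex set) \<Rightarrow> real ^ 3 \<Rightarrow> complex set" where
  "K_set A g = (\<Inter>i. closed_nbhd (g $ i) (A i))"

definition rot :: "real \<Rightarrow> complex \<Rightarrow> complex" where
  "rot \<phi> z = cis \<phi> * z"

text \<open>The points of the list lie on the unit circle and are met in this order when the circle is
  traversed once, in one of its two directions (\<open>s = 1\<close>: counterclockwise, \<open>s = -1\<close>:
  clockwise).\<close>

definition in_cyclic_order :: "complex list \<Rightarrow> bool" where
  "in_cyclic_order ps \<longleftrightarrow>
     (\<exists>s\<in>{1, -1::real}. \<exists>\<theta>s. \<theta>s \<noteq> [] \<and> sorted_wrt (<) \<theta>s \<and> last \<theta>s < hd \<theta>s + 2 * pi \<and>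
        ps = map (\<lambda>\<theta>. cis (s * \<theta>)) \<theta>s)"

definition inscribed_regular_triangle :: "(3 \<Rightarrow> complex) \<Rightarrow> bool" where
  "inscribed_regular_triangle a \<longleftrightarrow>
     (\<forall>i. a i \<in> sphere 0 1) \<and> inj a \<and> (\<exists>l. \<forall>i j. i \<noteq> j \<longrightarrow> dist (a i) (a j) = l)"

text \<open>The rotation by \<open>pi/3\<close> may have either orientation; the cyclic order then determines
  the labelling of the \<open>a i\<close>.\<close>

definition boundary_config :: "(3 \<Rightarrow> complex) \<Rightarrow> (3 \<Rightarrow> complex) \<Rightarrow> bool" where
  "boundary_config a b \<longleftrightarrow>
     inscribed_regular_triangle a \<and>
     (\<exists>\<phi>\<in>{pi / 3, - pi / 3}. \<forall>i. b i = rot \<phi> (a i)) \<and>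
     in_cyclic_order [a 1, b 1, a 2, b 2, a 3, b 3]"

text \<open>For \<open>sqrt 3 / 2 < \<omega> < 1\<close> the two circles around neighbouring vertices of a regular
  triangle inscribed in the unit circle meet in two points, at distances \<open>t\<close> and \<open>1 - t\<close>
  from \<open>o\<close>, where \<open>\<omega> = sqrt (1 + t\<^sup>2 - t)\<close> and \<open>0 < t < 1/2\<close>; so the closest point is unique.\<close>

definition closest_meet :: "complex \<Rightarrow> complex \<Rightarrow> real \<Rightarrow> complex" where
  "closest_meet p q \<omega> = arg_min_on norm (sphere p \<omega> \<inter> sphere q \<omega>)"

definition omega :: "real \<Rightarrow> real" where
  "omega t = sqrt (1 + t\<^sup>2 - t)"

definition T_ab :: "(3 \<Rightarrow> complex) \<Rightarrow> (3 \<Rightarrow> complex) \<Rightarrow> real \<Rightarrow> complex set" where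
  "T_ab a b t = {closest_meet (a 1) (a 2) (omega t), closest_meet (b 1) (b 2) (omega t)}"

definition t0 :: real where
  "t0 = sqrt 5 / 4 - 1 / 2 * sqrt (sqrt 5 - 7 / 4)"

definition omega0 :: real where
  "omega0 = sqrt (1 + t0\<^sup>2 - t0)"

definition dvec :: "real ^ 3" where
  "dvec = vector [omega0, omega0, sqrt (1 + t0\<^sup>2 + t0)]"

text \<open>One step of the cyclic permutation of the components: \<open>(g1, g2, g3)\<close> becomes
  \<open>(g2, g3, g1)\<close>.\<close>

definition cyc :: "real ^ 3 \<Rightarrow> real ^ 3" where
  "cyc g = vector [g $ 2, g $ 3, g $ 1]"

end

theory Submission
  imports Defs
begin

text \<open>
  The boundary is the vertex set of a regular hexagon. With \<open>e = b 1\<close> and \<open>f = a 2\<close> its vertices are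
  \<open>e - f, e, f, f - e, - e, - f\<close> in cyclic order, and consecutive ones are paired to \<open>A 1\<close>, \<open>A 2\<close> and
  \<open>A 3\<close>. In these terms \<open>K0 = {t0 e, t0 f}\<close> (\<open>closest_meet_hexagon\<close>).

  Let \<open>K\<close> be a compact with distances \<open>g 1\<close>, \<open>g 2\<close>, \<open>g 3\<close> to the boundary sets, and suppose that their
  sum is less than \<open>3\<close>. Every vertex belongs to a triple with one vertex from each boundary set such
  that a single point of \<open>K\<close> is within the three distances of the three vertices. Such a triple
  cannot be a regular triangle, whose Fermat point is its centre, with sum of distances \<open>3\<close>; and if
  it is not regular, it contains two opposite vertices, so that two of the \<open>g i\<close> have sum at least
  \<open>2\<close>. Since this cannot happen for all three pairs of indices, two complementary triangles must
  both occur (\<open>served_by_pair_cases\<close>); up to rotation they are \<open>e - f, f, - f\<close> and \<open>e, f - e, - e\<close>.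

  The reflection that exchanges \<open>e\<close> and \<open>f\<close> exchanges these triangles. Each of them has a weighted
  Fermat problem, with weights \<open>1 - \<mu>\<close>, \<open>1 + \<mu>\<close> and \<open>1\<close>, whose unique solution is \<open>t0 e\<close> or \<open>t0 f\<close>:
  the quartic equation satisfied by \<open>t0\<close> expresses the balance of forces there
  (\<open>triple_bound\<close>). Averaging the two weighted bounds gives
  \<open>g 1 + g 2 + g 3 \<ge> 2 * omega0 + W0\<close>, and equality forces both Fermat points into \<open>K\<close> and
  determines \<open>g\<close> (\<open>pair_bound\<close>). The bound is attained by \<open>K0\<close>, so it is the minimum.

  Therefore every Steiner compact has one of the three cyclic permutations of \<open>dvec\<close> as its vector
  of distances, and the class of \<open>dvec\<close> consists of the compacts between \<open>K0\<close> and \<open>K_set A dvec\<close>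
  (\<open>steiner_class_dvec_iff\<close>), whose least and greatest elements are these two sets. The rotation
  about \<open>o\<close> that permutes the boundary sets cyclically carries this class to the two others
  (\<open>steiner_class_rot\<close>).
\<close>

section \<open>Weighted Fermat points\<close>

text \<open>The norm is convex with gradient \<open>sgn (z - p)\<close> at \<open>z\<close>. The supporting inequality is the
  Cauchy-Schwarz inequality for \<open>x - p\<close> and the unit vector \<open>sgn (z - p)\<close>, and its equality case
  puts \<open>x\<close> on the line through \<open>p\<close> and \<open>z\<close>.\<close>
lemma norm_ge_supporting:
  fixes x z p :: "'a::real_inner"
  assumes "z \<noteq> p"
  shows "norm (z - p) + (x - z) \<bullet> sgn (z - p) \<le> norm (x - p)"
    and "norm (x - p) = norm (z - p) + (x - z) \<bullet> sgn (z - p) \<Longrightarrow> \<exists>c. x - z = c *\<^sub>R (z - p)"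
proof -
  have n: "norm (sgn (z - p)) = 1"
    using assms by (simp add: norm_sgn)
  have "(z - p) \<bullet> sgn (z - p) = norm (z - p)"
    using assms by (simp add: sgn_div_norm power2_norm_eq_inner[symmetric] power2_eq_square)
  then have eq: "(x - p) \<bullet> sgn (z - p) = norm (z - p) + (x - z) \<bullet> sgn (z - p)"
    by (simp add: inner_diff_left)
  then show "norm (z - p) + (x - z) \<bullet> sgn (z - p) \<le> norm (x - p)"
    using norm_cauchy_schwarz[of "x - p" "sgn (z - p)"] n by simp
  assume "norm (x - p) = norm (z - p) + (x - z) \<bullet> sgn (z - p)"
  then have "norm (x - p) *\<^sub>R sgn (z - p) = x - p"
    using norm_cauchy_schwarz_eq[of "x - p" "sgn (z - p)"] n eq by simp
  then have "x - z = (norm (x - p) / norm (z - p) - 1) *\<^sub>R (z - p)"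
    by (simp add: sgn_div_norm algebra_simps divide_inverse)
  then show "\<exists>c. x - z = c *\<^sub>R (z - p)" ..
qed

text \<open>At a balanced point the linear terms of the three supporting inequalities cancel, which makes
  the point a minimizer. A second minimizer would lie on the lines from \<open>z\<close> to \<open>p\<close> and to
  \<open>q\<close>, and these meet only in \<open>z\<close>.\<close>
lemma weighted_fermat:
  fixes x z p q r :: "'a::real_inner"
  assumes "z \<noteq> p" "z \<noteq> q" "z \<noteq> r"
    and "\<alpha> > 0" "\<beta> > 0" "\<gamma> > 0"
    and balance: "\<alpha> *\<^sub>R sgn (z - p) + \<beta> *\<^sub>R sgn (z - q) + \<gamma> *\<^sub>R sgn (z - r) = 0"
  shows "\<alpha> * norm (z - p) + \<beta> * norm (z - q) + \<gamma> * norm (z - r)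
           \<le> \<alpha> * norm (x - p) + \<beta> * norm (x - q) + \<gamma> * norm (x - r)" (is "?m \<le> ?f")
    and "\<lbrakk>\<alpha> * norm (x - p) + \<beta> * norm (x - q) + \<gamma> * norm (x - r)
           \<le> \<alpha> * norm (z - p) + \<beta> * norm (z - q) + \<gamma> * norm (z - r);
          \<And>c. z - p \<noteq> c *\<^sub>R (z - q)\<rbrakk> \<Longrightarrow> x = z"
proof -
  define lp where "lp = norm (z - p) + (x - z) \<bullet> sgn (z - p)"
  define lq where "lq = norm (z - q) + (x - z) \<bullet> sgn (z - q)"
  define lr where "lr = norm (z - r) + (x - z) \<bullet> sgn (z - r)"
  have le: "\<alpha> * lp \<le> \<alpha> * norm (x - p)" "\<beta> * lq \<le> \<beta> * norm (x - q)" "\<gamma> * lr \<le> \<gamma> * norm (x - r)"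
    using norm_ge_supporting(1) assms unfolding lp_def lq_def lr_def by auto
  have "(x - z) \<bullet> (\<alpha> *\<^sub>R sgn (z - p) + \<beta> *\<^sub>R sgn (z - q) + \<gamma> *\<^sub>R sgn (z - r)) = 0"
    unfolding balance by simp
  then have m: "?m = \<alpha> * lp + \<beta> * lq + \<gamma> * lr"
    unfolding lp_def lq_def lr_def inner_add_right inner_scaleR_right by (simp add: algebra_simps)
  show "?m \<le> ?f" using le m by linarith
  assume "?f \<le> ?m" and nonpar: "\<And>c. z - p \<noteq> c *\<^sub>R (z - q)"
  then have "\<alpha> * lp = \<alpha> * norm (x - p)" "\<beta> * lq = \<beta> * norm (x - q)"
    using le m by linarith+
  then have "norm (x - p) = lp" "norm (x - q) = lq" using assms by auto
  then obtain c c' where c: "x - z = c *\<^sub>R (z - p)" and c': "x - z = c' *\<^sub>R (z - q)"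
    using norm_ge_supporting(2) assms unfolding lp_def lq_def by metis
  have "c = 0"
  proof (rule ccontr)
    assume "c \<noteq> 0"
    then have "z - p = (c' / c) *\<^sub>R (z - q)"
      using c c' by (metis (no_types) divide_inverse mult.commute scaleR_one scaleR_scaleR right_inverse left_inverse)
    with nonpar show False by blast
  qed
  with c show "x = z" by simp
qed

section \<open>The number t0 and the minimal value\<close>

lemma sqrt5_bounds: "22360679 / 10000000 < sqrt (5::real)" "sqrt (5::real) < 2236068 / 1000000"
  by (rule real_less_rsqrt, simp add: power2_eq_square)
     (rule real_less_lsqrt, simp_all add: power2_eq_square)

lemma sqrt_q_bounds:
  "697185 / 1000000 < sqrt (sqrt 5 - 7 / 4 :: real)"
  "sqrt (sqrt 5 - 7 / 4 :: real) < 697186 / 1000000"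
  by (rule real_less_rsqrt, use sqrt5_bounds in \<open>simp add: power2_eq_square\<close>)
     (rule real_less_lsqrt, use sqrt5_bounds in \<open>simp_all add: power2_eq_square\<close>)

lemma t0_bounds: "0 < t0" "t0 < 1 / 2"
  using sqrt5_bounds sqrt_q_bounds unfolding t0_def by linarith+

text \<open>The third component of \<open>dvec\<close>; the minimal value is \<open>2 * omega0 + W0\<close>.\<close>
definition W0 :: real where "W0 = sqrt (1 + t0\<^sup>2 + t0)"

text \<open>\<open>t0\<close> is a root of one of the two quadratic factors over the field generated by \<open>sqrt 5\<close> of
  the quartic below.\<close>
lemma t0_quadratic: "t0\<^sup>2 = sqrt 5 / 2 * t0 + sqrt 5 / 4 - 3 / 4"
proof -
  define q where "q = sqrt (sqrt 5 - 7 / 4)"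
  have "q\<^sup>2 = sqrt 5 - 7 / 4" unfolding q_def using sqrt5_bounds by simp
  moreover have "(sqrt 5)\<^sup>2 = (5::real)" by simp
  moreover have "t0 = sqrt 5 / 4 - 1 / 2 * q" unfolding t0_def q_def by simp
  ultimately show ?thesis by algebra
qed

lemma t0_quartic: "4 * t0 ^ 4 + t0\<^sup>2 - 5 * t0 + 1 = 0"
proof -
  define s :: real where "s = sqrt 5"
  have s: "s\<^sup>2 = 5" by (simp add: s_def)
  have "4 * t0 ^ 4 + t0\<^sup>2 - 5 * t0 + 1 =
      4 * (t0\<^sup>2 - (s / 2 * t0 + s / 4 - 3 / 4)) * (t0\<^sup>2 + s / 2 * t0 + s / 4 + 3 / 4)
      + (s\<^sup>2 - 5) * (t0 + 1 / 2)\<^sup>2"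
    by (simp add: field_simps power2_eq_square power4_eq_xxxx)
  then show ?thesis using t0_quadratic s by (simp add: s_def)
qed

lemma omega0_pos: "omega0 > 0" and W0_pos: "W0 > 0"
  and omega0_sq: "omega0\<^sup>2 = 1 + t0\<^sup>2 - t0" and W0_sq: "W0\<^sup>2 = 1 + t0\<^sup>2 + t0"
proof -
  have "0 < 1 + t0\<^sup>2 - t0" "0 < 1 + t0\<^sup>2 + t0" using t0_bounds zero_le_power2[of t0] by linarith+
  then show "omega0 > 0" "W0 > 0" "omega0\<^sup>2 = 1 + t0\<^sup>2 - t0" "W0\<^sup>2 = 1 + t0\<^sup>2 + t0"
    unfolding omega0_def W0_def by simp_all
qed

lemma omega0_less_W0: "omega0 < W0"
  unfolding omega0_def W0_def using t0_bounds by simp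

text \<open>This says that the derivative of \<open>2 * omega t + sqrt (1 + t\<^sup>2 + t)\<close> vanishes at \<open>t0\<close>. It is the
  component along \<open>e\<close> of the balance of forces at the Fermat point \<open>t0 e\<close>; squaring it yields the
  quartic.\<close>
lemma t0_stationary: "2 * (1 - 2 * t0) * W0 = (1 + 2 * t0) * omega0"
proof (rule power2_eq_imp_eq)
  show "(2 * (1 - 2 * t0) * W0)\<^sup>2 = ((1 + 2 * t0) * omega0)\<^sup>2"
    unfolding power_mult_distrib W0_sq omega0_sq using t0_quartic by algebra
  show "0 \<le> 2 * (1 - 2 * t0) * W0" "0 \<le> (1 + 2 * t0) * omega0"
    using t0_bounds omega0_pos W0_pos by auto
qed

text \<open>The root on the left lies in the field generated by \<open>q = sqrt (sqrt 5 - 7 / 4)\<close>, which also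
  contains \<open>t0\<close>; this is what allows the nested radical of the minimal value to be compared with
  an expression in \<open>t0\<close>.\<close>
lemma nested_root: "sqrt (- 47 + 80 * sqrt 5) = 2 * (6 + sqrt 5) * sqrt (sqrt 5 - 7 / 4)"
proof (rule real_sqrt_unique)
  have "(sqrt (sqrt 5 - 7 / 4))\<^sup>2 = sqrt 5 - 7 / (4::real)" using sqrt5_bounds by simp
  moreover have "(sqrt 5)\<^sup>2 = (5::real)" by simp
  ultimately show "(2 * (6 + sqrt 5) * sqrt (sqrt 5 - 7 / 4))\<^sup>2 = - 47 + 80 * sqrt (5::real)"
    by algebra
  show "0 \<le> 2 * (6 + sqrt 5) * sqrt (sqrt 5 - 7 / (4::real))"
    using sqrt5_bounds by simp
qed

lemma min_value_sq: "(2 * omega0 + W0)\<^sup>2 = 35 / 8 + 3 / 8 * sqrt (- 47 + 80 * sqrt 5)"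
proof -
  define q where "q = sqrt (sqrt 5 - 7 / 4)"
  have q: "q\<^sup>2 = sqrt 5 - 7 / 4" unfolding q_def using sqrt5_bounds by simp
  have s: "(sqrt 5)\<^sup>2 = (5::real)" by simp
  have t: "t0 = sqrt 5 / 4 - 1 / 2 * q" unfolding t0_def q_def by simp
  \<comment> \<open>The mixed term \<open>4 * omega0 * W0\<close> is rational in \<open>t0\<close> by stationarity, with denominator
    \<open>1 - 2 * t0\<close>.\<close>
  have "(1 - 2 * t0) * (2 * omega0 + W0)\<^sup>2 =
      (1 - 2 * t0) * (5 + 5 * t0\<^sup>2 - 3 * t0) + 2 * (1 + 2 * t0) * (1 - t0 + t0\<^sup>2)"
    using t0_stationary omega0_sq W0_sq by algebra
  also have "\<dots> = (1 - 2 * t0) * (35 / 8 + 3 / 4 * (6 + sqrt 5) * q)"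
    using q s t by algebra
  finally have "(2 * omega0 + W0)\<^sup>2 = 35 / 8 + 3 / 4 * (6 + sqrt 5) * q" using t0_bounds by simp
  then show ?thesis unfolding nested_root q_def by simp
qed

lemma min_value: "2 * omega0 + W0 = sqrt (35 / 8 + 3 / 8 * sqrt (- 47 + 80 * sqrt 5))"
  using min_value_sq omega0_pos W0_pos by (intro real_sqrt_unique[symmetric]) auto

lemma min_value_bounds: "\<bar>2 * omega0 + W0 - 2.94645\<bar> \<le> 0.000005"
proof -
  let ?r = "3 / 4 * (6 + sqrt 5) * sqrt (sqrt 5 - 7 / 4)"
  have lo: "3 / 4 * (6 + 22360679 / 10000000) * (697185 / 1000000) \<le> ?r"
    using sqrt5_bounds sqrt_q_bounds by (intro mult_mono) auto
  have hi: "?r \<le> 3 / 4 * (6 + 2236068 / 1000000) * (697186 / 1000000)"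
    using sqrt5_bounds sqrt_q_bounds by (intro mult_mono) auto
  have sq: "(2 * omega0 + W0)\<^sup>2 = 35 / 8 + ?r" unfolding min_value_sq nested_root by simp
  have "(2946445 / 1000000)\<^sup>2 \<le> (2 * omega0 + W0)\<^sup>2"
    using lo unfolding sq by (simp add: power2_eq_square)
  moreover have "(2 * omega0 + W0)\<^sup>2 \<le> (2946455 / 1000000)\<^sup>2"
    using hi unfolding sq by (simp add: power2_eq_square)
  ultimately have "(2946445 / 1000000) \<le> 2 * omega0 + W0" "2 * omega0 + W0 \<le> (2946455 / 1000000)"
    by (auto intro: power2_le_imp_le[of _ "2 * omega0 + W0"] power2_le_imp_le[of "2 * omega0 + W0"]
        simp: omega0_pos W0_pos less_imp_le)
  then show ?thesis unfolding abs_le_iff by simp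
qed

section \<open>The hexagon spanned by two unit vectors\<close>

context
  fixes e f :: "'a::real_inner"
  assumes e: "norm e = 1" and f: "norm f = 1" and ef: "e \<bullet> f = 1 / 2"
begin

lemma norm_lincomb: "norm (a *\<^sub>R e + b *\<^sub>R f) = sqrt (a\<^sup>2 + b\<^sup>2 + a * b)"
proof -
  have "e \<bullet> e = 1" "f \<bullet> f = 1" using e f by (simp_all add: norm_eq_1)
  then show ?thesis
    unfolding norm_eq_sqrt_inner
    by (simp add: ef inner_add inner_commute[of f e] power2_eq_square algebra_simps)
qed

lemma lincomb_eq_0: "a *\<^sub>R e + b *\<^sub>R f = 0 \<Longrightarrow> a = 0 \<and> b = 0"
proof -
  assume "a *\<^sub>R e + b *\<^sub>R f = 0"
  then have "a\<^sup>2 + b\<^sup>2 + a * b = 0" using norm_lincomb[of a b] by (metis norm_zero real_sqrt_eq_zero_cancel_iff)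
  then have "(a + b / 2)\<^sup>2 + 3 / 4 * b\<^sup>2 = 0" by (simp add: power2_eq_square algebra_simps)
  then have "(a + b / 2)\<^sup>2 = 0 \<and> b\<^sup>2 = 0"
    using zero_le_power2[of "a + b / 2"] zero_le_power2[of b] by linarith
  then show ?thesis by simp
qed

lemma hexagon_dist:
  "norm (t *\<^sub>R e - (e - f)) = omega t" "norm (t *\<^sub>R e - f) = omega t"
  "norm (t *\<^sub>R e + f) = sqrt (1 + t\<^sup>2 + t)"
  using norm_lincomb[of "t - 1" 1] norm_lincomb[of t "-1"] norm_lincomb[of t 1]
  by (simp_all add: omega_def algebra_simps power2_eq_square)

text \<open>The weights turn \<open>t0 e\<close> into the weighted Fermat point of the three vertices \<open>e - f\<close>, \<open>f\<close> and
  \<open>- f\<close>. With total weight \<open>2\<close> on the first two vertices and weight \<open>1\<close> on the third, the component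
  along \<open>f\<close> of the balance of forces determines \<open>\<mu>\<close>, and the component along \<open>e\<close> becomes the
  stationarity equation of \<open>t0\<close>.\<close>
lemma triple_bound:
  assumes x: "norm (x - (e - f)) \<le> g1" "norm (x - f) \<le> g2" "norm (x + f) \<le> g3"
  defines "\<mu> \<equiv> omega0 / (2 * W0)"
  shows "2 * omega0 + W0 \<le> (1 - \<mu>) * g1 + (1 + \<mu>) * g2 + g3"
    and "(1 - \<mu>) * g1 + (1 + \<mu>) * g2 + g3 \<le> 2 * omega0 + W0 \<Longrightarrow>
           x = t0 *\<^sub>R e \<and> g1 = omega0 \<and> g2 = omega0 \<and> g3 = W0"
proof -
  have om: "omega t0 = omega0" by (simp add: omega_def omega0_def)
  let ?z = "t0 *\<^sub>R e"
  have d: "norm (?z - (e - f)) = omega0" "norm (?z - f) = omega0" "norm (?z - (- f)) = W0"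
    using hexagon_dist[of t0] by (simp_all add: om W0_def)
  have mu: "0 < \<mu>" "\<mu> < 1" unfolding \<mu>_def using omega0_pos W0_pos omega0_less_W0 by auto
  have ne: "?z \<noteq> e - f" "?z \<noteq> f" "?z \<noteq> - f" using d omega0_pos W0_pos by force+
  have c: "(2 * t0 - 1) / omega0 + (1 + 2 * t0) / (2 * W0) = 0"
    using t0_stationary omega0_pos W0_pos by (simp add: add_frac_eq) algebra
  have collect: "\<alpha> *\<^sub>R (?z - (e - f)) + \<beta> *\<^sub>R (?z - f) + \<gamma> *\<^sub>R (?z - (- f))
      = (\<alpha> * (t0 - 1) + \<beta> * t0 + \<gamma> * t0) *\<^sub>R e + (\<alpha> - \<beta> + \<gamma>) *\<^sub>R f" for \<alpha> \<beta> \<gamma>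
    by (simp add: algebra_simps)
  have "(1 - \<mu>) *\<^sub>R sgn (?z - (e - f)) + (1 + \<mu>) *\<^sub>R sgn (?z - f) + 1 *\<^sub>R sgn (?z - (- f))
      = ((1 - \<mu>) / omega0) *\<^sub>R (?z - (e - f)) + ((1 + \<mu>) / omega0) *\<^sub>R (?z - f) + (1 / W0) *\<^sub>R (?z - (- f))"
    unfolding sgn_div_norm d by (simp add: divide_inverse)
  also have "\<dots> = ((1 - \<mu>) / omega0 * (t0 - 1) + (1 + \<mu>) / omega0 * t0 + 1 / W0 * t0) *\<^sub>R e
                   + ((1 - \<mu>) / omega0 - (1 + \<mu>) / omega0 + 1 / W0) *\<^sub>R f"
    unfolding collect ..
  also have "(1 - \<mu>) / omega0 * (t0 - 1) + (1 + \<mu>) / omega0 * t0 + 1 / W0 * t0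
       = (2 * t0 - 1) / omega0 + (1 + 2 * t0) / (2 * W0)"
    unfolding \<mu>_def using omega0_pos W0_pos by (simp add: field_simps)
  also have "(1 - \<mu>) / omega0 - (1 + \<mu>) / omega0 + 1 / W0 = 0"
    unfolding \<mu>_def using omega0_pos W0_pos by (simp add: field_simps)
  finally have balance: "(1 - \<mu>) *\<^sub>R sgn (?z - (e - f)) + (1 + \<mu>) *\<^sub>R sgn (?z - f) + 1 *\<^sub>R sgn (?z - (- f)) = 0"
    by (simp add: c)
  have pos: "0 < 1 - \<mu>" "0 < 1 + \<mu>" "0 < (1::real)" using mu by auto
  note fermat = weighted_fermat[OF ne pos balance, of x, unfolded d]
  have le: "(1 - \<mu>) * norm (x - (e - f)) \<le> (1 - \<mu>) * g1" "(1 + \<mu>) * norm (x - f) \<le> (1 + \<mu>) * g2"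
    using x pos by (auto intro: mult_left_mono)
  have val: "(1 - \<mu>) * omega0 + (1 + \<mu>) * omega0 + 1 * W0 = 2 * omega0 + W0" by (simp add: algebra_simps)
  show "2 * omega0 + W0 \<le> (1 - \<mu>) * g1 + (1 + \<mu>) * g2 + g3"
    using fermat(1) le x(3) unfolding val by simp
  assume tight: "(1 - \<mu>) * g1 + (1 + \<mu>) * g2 + g3 \<le> 2 * omega0 + W0"
  have nonpar: "?z - (e - f) \<noteq> c *\<^sub>R (?z - f)" for c
  proof
    assume "?z - (e - f) = c *\<^sub>R (?z - f)"
    then have "(t0 - 1 - c * t0) *\<^sub>R e + (1 + c) *\<^sub>R f = 0" by (simp add: algebra_simps)
    then have "t0 - 1 - c * t0 = 0" "1 + c = 0" using lincomb_eq_0 by blast+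
    then have "t0 - 1 - (- 1) * t0 = 0" by (metis add_eq_0_iff)
    with t0_bounds show False by simp
  qed
  have "x = ?z"
    using fermat(2)[OF _ nonpar] tight le x(3) unfolding val by auto
  moreover from this have "omega0 \<le> g1" "omega0 \<le> g2" "W0 \<le> g3"
    using x d by auto
  moreover from this have "(1 - \<mu>) * omega0 \<le> (1 - \<mu>) * g1" "(1 + \<mu>) * omega0 \<le> (1 + \<mu>) * g2"
    using pos by auto
  ultimately have "x = ?z" "(1 - \<mu>) * omega0 = (1 - \<mu>) * g1" "(1 + \<mu>) * omega0 = (1 + \<mu>) * g2" "W0 = g3"
    using tight val by linarith+
  then show "x = ?z \<and> g1 = omega0 \<and> g2 = omega0 \<and> g3 = W0" using pos by auto
qed

end

text \<open>The triangles \<open>e - f\<close>, \<open>f\<close>, \<open>- f\<close> and \<open>f - e\<close>, \<open>e\<close>, \<open>- e\<close> are mirror images under the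
  exchange of \<open>e\<close> and \<open>f\<close>. A mirror image exchanges the roles of \<open>g1\<close> and \<open>g2\<close>, so the average of the
  two weighted bounds has all weights equal to one; and if the average is tight, so are both
  bounds.\<close>
lemma pair_bound:
  fixes e f x y :: "'a::real_inner"
  assumes hex: "norm e = 1" "norm f = 1" "e \<bullet> f = 1 / 2"
    and x: "norm (x - (e - f)) \<le> g1" "norm (x - f) \<le> g2" "norm (x + f) \<le> g3"
    and y: "norm (y - e) \<le> g1" "norm (y - (f - e)) \<le> g2" "norm (y + e) \<le> g3"
  shows "2 * omega0 + W0 \<le> g1 + g2 + g3"
    and "g1 + g2 + g3 \<le> 2 * omega0 + W0 \<Longrightarrow>
          x = t0 *\<^sub>R e \<and> y = t0 *\<^sub>R f \<and> g1 = omega0 \<and> g2 = omega0 \<and> g3 = W0"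
proof -
  have hex': "f \<bullet> e = 1 / 2" using hex by (simp add: inner_commute)
  note tx = triple_bound[OF hex x] and ty = triple_bound[OF hex(2,1) hex' y(2,1,3)]
  define h where "h = (1 - omega0 / (2 * W0)) * g1 + (1 + omega0 / (2 * W0)) * g2 + g3"
  define h' where "h' = (1 - omega0 / (2 * W0)) * g2 + (1 + omega0 / (2 * W0)) * g1 + g3"
  have avg: "h + h' = 2 * g1 + 2 * g2 + 2 * g3" unfolding h_def h'_def by (simp add: algebra_simps)
  have le: "2 * omega0 + W0 \<le> h" "2 * omega0 + W0 \<le> h'"
    using tx(1) ty(1) unfolding h_def h'_def by blast+
  show "2 * omega0 + W0 \<le> g1 + g2 + g3" using avg le by linarith
  assume "g1 + g2 + g3 \<le> 2 * omega0 + W0"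
  then have "h \<le> 2 * omega0 + W0" "h' \<le> 2 * omega0 + W0" using le avg by linarith+
  then show "x = t0 *\<^sub>R e \<and> y = t0 *\<^sub>R f \<and> g1 = omega0 \<and> g2 = omega0 \<and> g3 = W0"
    using tx(2) ty(2) unfolding h_def h'_def by blast
qed

section \<open>Hausdorff distances between compact sets\<close>

lemma infdist_le_iff:
  fixes B :: "'a::heine_borel set"
  assumes "B \<in> compacts"
  shows "infdist x B \<le> r \<longleftrightarrow> (\<exists>y\<in>B. dist x y \<le> r)"
proof
  assume le: "infdist x B \<le> r"
  have "closed B" "B \<noteq> {}" using assms by (auto simp: compacts_def compact_imp_closed)
  then obtain y where "y \<in> B" "infdist x B = dist x y" by (rule infdist_attains_inf)
  with le show "\<exists>y\<in>B. dist x y \<le> r" by auto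
qed (auto intro: infdist_le2)

lemma hausdorff_dist_le_iff:
  fixes K L :: "'a::heine_borel set"
  assumes "K \<in> compacts" "L \<in> compacts"
  shows "hausdorff_dist K L \<le> r \<longleftrightarrow>
    (\<forall>x\<in>K. \<exists>y\<in>L. dist x y \<le> r) \<and> (\<forall>y\<in>L. \<exists>x\<in>K. dist x y \<le> r)"
proof -
  have sup: "(SUP x\<in>B. infdist x C) \<le> r \<longleftrightarrow> (\<forall>x\<in>B. infdist x C \<le> r)" if "B \<in> compacts" for B C :: "'a set"
  proof (rule cSUP_le_iff)
    have "compact ((\<lambda>x. infdist x C) ` B)"
      using that by (intro compact_continuous_image continuous_intros) (auto simp: compacts_def)
    then show "bdd_above ((\<lambda>x. infdist x C) ` B)"
      by (intro bounded_imp_bdd_above compact_imp_bounded)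
  qed (use that in \<open>auto simp: compacts_def\<close>)
  show ?thesis
    unfolding hausdorff_dist_def max.bounded_iff sup[OF assms(1)] sup[OF assms(2)]
      infdist_le_iff[OF assms(1)] infdist_le_iff[OF assms(2)] by (simp add: dist_commute)
qed

lemma hausdorff_dist_image:
  assumes "\<And>x y. dist (h x) (h y) = dist x y"
  shows "hausdorff_dist (h ` K) (h ` L) = hausdorff_dist K L"
  unfolding hausdorff_dist_def infdist_def image_image assms by (simp add: image_comp)

lemma steiner_sum_expand:
  "steiner_sum A K = hausdorff_dist K (A 1) + hausdorff_dist K (A 2) + hausdorff_dist K (A 3)"
  unfolding steiner_sum_def by (rule sum_3)

section \<open>The minimal sum of distances\<close>

text \<open>The index type is cyclic, so that \<open>i + 1\<close> is the next of the three boundary sets.\<close>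
lemma index_succ: "1 + 1 = (2::3)" "2 + 1 = (3::3)" "3 + 1 = (1::3)"
  by simp_all

text \<open>With \<open>e = b 1\<close> and \<open>f = a 2\<close> the vertices \<open>a 1, b 1, a 2, b 2, a 3, b 3\<close> are
  \<open>e - f, e, f, f - e, - e, - f\<close>. Only the inner products enter, so the two orientations of the
  configuration need no separate treatment.\<close>
definition hexagonal :: "(3 \<Rightarrow> complex set) \<Rightarrow> complex \<Rightarrow> complex \<Rightarrow> bool" where
  "hexagonal A e f \<longleftrightarrow> norm e = 1 \<and> norm f = 1 \<and> e \<bullet> f = 1 / 2 \<and>
     A 1 = {e - f, e} \<and> A 2 = {f, f - e} \<and> A 3 = {- e, - f}"

lemma hexagonal_compacts: "hexagonal A e f \<Longrightarrow> A i \<in> compacts"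
  using exhaust_3[of i] by (auto simp: hexagonal_def compacts_def finite_imp_compact)

text \<open>Renaming the first boundary set into the last one replaces \<open>e\<close> and \<open>f\<close> by their rotated
  images \<open>f - e\<close> and \<open>- e\<close>. It transports the estimate for one pair of triangles to the other two
  pairs.\<close>
lemma hexagonal_shift:
  assumes "hexagonal A e f"
  shows "hexagonal (\<lambda>i. A (i + 1)) (f - e) (- e)"
proof -
  have "norm e = 1" "norm f = 1" "e \<bullet> f = 1 / 2" using assms unfolding hexagonal_def by auto
  moreover from this have "norm (f - e) = 1"
    using norm_lincomb[of e f "-1" 1] by simp
  moreover from calculation have "(f - e) \<bullet> (- e) = 1 / 2"
    by (simp add: inner_diff_left inner_commute[of f e] norm_eq_1)
  ultimately show ?thesis
    using assms unfolding hexagonal_def index_succ by auto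
qed

text \<open>Both complementary triangles are written in terms of \<open>e\<close> and \<open>f\<close>, and the radii are arguments,
  so that cyclic renamings of the boundary sets give the other two pairs of triangles.\<close>
definition served_by_pair :: "complex set \<Rightarrow> complex \<Rightarrow> complex \<Rightarrow> real \<Rightarrow> real \<Rightarrow> real \<Rightarrow> bool" where
  "served_by_pair K e f g1 g2 g3 \<longleftrightarrow>
     (\<exists>x\<in>K. norm (x - (e - f)) \<le> g1 \<and> norm (x - f) \<le> g2 \<and> norm (x + f) \<le> g3) \<and>
     (\<exists>y\<in>K. norm (y - e) \<le> g1 \<and> norm (y - (f - e)) \<le> g2 \<and> norm (y + e) \<le> g3)"

lemma fermat_regular_triangle:
  fixes x :: "'a::real_inner"
  assumes "norm p = 1" "norm q = 1" "norm r = 1" "p + q + r = 0"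
  shows "3 \<le> norm (x - p) + norm (x - q) + norm (x - r)"
proof -
  have "1 *\<^sub>R sgn (0 - p) + 1 *\<^sub>R sgn (0 - q) + 1 *\<^sub>R sgn (0 - r) = - (p + q + r)"
    using assms(1-3) by (simp add: sgn_div_norm)
  then have "1 *\<^sub>R sgn (0 - p) + 1 *\<^sub>R sgn (0 - q) + 1 *\<^sub>R sgn (0 - r) = 0"
    unfolding assms(4) by simp
  then show ?thesis
    using weighted_fermat(1)[of 0 p q r 1 1 1 x] assms by force
qed

lemma opposite_vertices:
  fixes x p :: "'a::real_normed_vector"
  assumes "norm p = 1" "norm (x - p) \<le> r" "norm (x + p) \<le> s"
  shows "2 \<le> r + s"
proof -
  have "norm (x + p - (x - p)) \<le> norm (x + p) + norm (x - p)" by (rule norm_triangle_ineq4)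
  moreover have "x + p - (x - p) = 2 *\<^sub>R p" by (simp add: scaleR_2)
  ultimately show ?thesis using assms by simp
qed

text \<open>A vertex of one boundary set is reached by a point of \<open>K\<close>, which in turn lies close to a vertex
  of each other set; so every vertex belongs to a triple, one vertex from each set, that a single
  point of \<open>K\<close> reaches. The two regular triangles are too expensive for such a triple by Fermat's
  inequality. Each of the other six triples contains a pair of opposite vertices, from sets \<open>i\<close> and
  \<open>j\<close> say, and forces \<open>g i + g j \<ge> 2\<close>. This cannot hold for all three pairs of sets. When it fails
  for the first and second set, the only triple left for \<open>e - f\<close> is \<open>e - f, f, - f\<close>, and the only
  one left for \<open>f - e\<close> is its complement; the other two cases are cyclic permutations of this
  one.\<close>
lemma served_by_pair_cases:
  assumes hex: "hexagonal A e f" and K: "K \<in> compacts"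
    and g: "\<And>i. hausdorff_dist K (A i) = g i"
    and less3: "g 1 + g 2 + g 3 < 3"
  shows "served_by_pair K e f (g 1) (g 2) (g 3) \<or>
         served_by_pair K (f - e) (- e) (g 2) (g 3) (g 1) \<or>
         served_by_pair K (- f) (e - f) (g 3) (g 1) (g 2)"
proof -
  have n: "norm e = 1" "norm f = 1" "e \<bullet> f = 1 / 2"
    and A: "A 1 = {e - f, e}" "A 2 = {f, f - e}" "A 3 = {- e, - f}"
    using hex unfolding hexagonal_def by auto
  have n': "norm (e - f) = 1" "norm (f - e) = 1"
    using norm_lincomb[OF n, of 1 "-1"] norm_minus_commute[of e f] by auto
  have near: "(\<forall>x\<in>K. \<exists>p\<in>A i. norm (x - p) \<le> g i) \<and> (\<forall>p\<in>A i. \<exists>x\<in>K. norm (x - p) \<le> g i)" for i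
    using hausdorff_dist_le_iff[OF K hexagonal_compacts[OF hex], of i "g i"] g by (simp add: dist_norm)
  define Q where "Q p q r \<longleftrightarrow> (\<exists>x\<in>K. norm (x - p) \<le> g 1 \<and> norm (x - q) \<le> g 2 \<and> norm (x - r) \<le> g 3)" for p q r
  have Q: "p \<in> A 1 \<Longrightarrow> \<exists>q\<in>A 2. \<exists>r\<in>A 3. Q p q r"
     "q \<in> A 2 \<Longrightarrow> \<exists>p\<in>A 1. \<exists>r\<in>A 3. Q p q r"
     "r \<in> A 3 \<Longrightarrow> \<exists>p\<in>A 1. \<exists>q\<in>A 2. Q p q r" for p q r
    unfolding Q_def using near[of 1] near[of 2] near[of 3] by meson+
  have covers: "Q (e - f) f (- e) \<or> Q (e - f) f (- f) \<or> Q (e - f) (f - e) (- e) \<or> Q (e - f) (f - e) (- f)"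
    "Q e f (- e) \<or> Q e f (- f) \<or> Q e (f - e) (- e) \<or> Q e (f - e) (- f)"
    "Q (e - f) f (- e) \<or> Q (e - f) f (- f) \<or> Q e f (- e) \<or> Q e f (- f)"
    "Q (e - f) (f - e) (- e) \<or> Q (e - f) (f - e) (- f) \<or> Q e (f - e) (- e) \<or> Q e (f - e) (- f)"
    "Q (e - f) f (- e) \<or> Q (e - f) (f - e) (- e) \<or> Q e f (- e) \<or> Q e (f - e) (- e)"
    "Q (e - f) f (- f) \<or> Q (e - f) (f - e) (- f) \<or> Q e f (- f) \<or> Q e (f - e) (- f)"
    using Q(1)[of "e - f"] Q(1)[of e] Q(2)[of f] Q(2)[of "f - e"] Q(3)[of "- e"] Q(3)[of "- f"]
    unfolding A by blast+
  have regular: "\<not> Q p q r" if "norm p = 1" "norm q = 1" "norm r = 1" "p + q + r = 0" for p q r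
    unfolding Q_def using fermat_regular_triangle[OF that] less3 by (meson add_mono leD order.strict_trans1)
  have no: "\<not> Q (e - f) f (- e)" "\<not> Q e (f - e) (- f)"
    using regular[of "e - f" f "- e"] regular[of e "f - e" "- f"] n n' by simp_all
  have opp: "2 \<le> r + s" if "norm (x - p) \<le> r" "norm (x - q) \<le> s" "q = - p" "norm p = 1" for x p q :: complex and r s
    using opposite_vertices[of p x r s] that by simp
  have opp12: "Q p q r \<Longrightarrow> q = - p \<Longrightarrow> norm p = 1 \<Longrightarrow> 2 \<le> g 1 + g 2"
    and opp13: "Q p q r \<Longrightarrow> r = - p \<Longrightarrow> norm p = 1 \<Longrightarrow> 2 \<le> g 1 + g 3"
    and opp23: "Q p q r \<Longrightarrow> r = - q \<Longrightarrow> norm q = 1 \<Longrightarrow> 2 \<le> g 2 + g 3" for p q r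
    unfolding Q_def using opp by blast+
  have triples: "Q e f (- e) \<Longrightarrow> 2 \<le> g 1 + g 3" "Q e (f - e) (- e) \<Longrightarrow> 2 \<le> g 1 + g 3"
    by (erule opp13; simp add: n)+
  have triples': "Q (e - f) (f - e) (- e) \<Longrightarrow> 2 \<le> g 1 + g 2" "Q (e - f) (f - e) (- f) \<Longrightarrow> 2 \<le> g 1 + g 2"
    by (erule opp12; simp add: n')+
  have triples'': "Q (e - f) f (- f) \<Longrightarrow> 2 \<le> g 2 + g 3" "Q e f (- f) \<Longrightarrow> 2 \<le> g 2 + g 3"
    by (erule opp23; simp add: n)+
  have negate: "norm (y + (u - v)) = norm (y - (v - u))" for y u v :: complex by (simp add: algebra_simps)
  have "\<not> (2 \<le> g 1 + g 3 \<and> 2 \<le> g 1 + g 2 \<and> 2 \<le> g 2 + g 3)" using less3 by linarith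
  then have "(Q (e - f) f (- f) \<and> Q e (f - e) (- e)) \<or> (Q e f (- e) \<and> Q (e - f) (f - e) (- f)) \<or>
    (Q (e - f) (f - e) (- e) \<and> Q e f (- f))"
    using covers no triples triples' triples'' by argo
  moreover have "Q (e - f) f (- f) \<and> Q e (f - e) (- e) \<Longrightarrow> served_by_pair K e f (g 1) (g 2) (g 3)"
    unfolding Q_def served_by_pair_def by simp
  moreover have "Q e f (- e) \<and> Q (e - f) (f - e) (- f) \<Longrightarrow> served_by_pair K (f - e) (- e) (g 2) (g 3) (g 1)"
    unfolding Q_def served_by_pair_def negate by auto
  moreover have "Q (e - f) (f - e) (- e) \<and> Q e f (- f) \<Longrightarrow> served_by_pair K (- f) (e - f) (g 3) (g 1) (g 2)"
    unfolding Q_def served_by_pair_def negate by auto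
  ultimately show ?thesis by blast
qed

lemma served_by_pair_bound:
  assumes "norm e = 1" "norm f = 1" "e \<bullet> f = 1 / 2" "served_by_pair K e f g1 g2 g3"
  shows "2 * omega0 + W0 \<le> g1 + g2 + g3"
    and "g1 + g2 + g3 \<le> 2 * omega0 + W0 \<Longrightarrow>
           {t0 *\<^sub>R e, t0 *\<^sub>R f} \<subseteq> K \<and> g1 = omega0 \<and> g2 = omega0 \<and> g3 = W0"
proof -
  obtain x y where "x \<in> K" "y \<in> K"
    and x: "norm (x - (e - f)) \<le> g1" "norm (x - f) \<le> g2" "norm (x + f) \<le> g3"
    and y: "norm (y - e) \<le> g1" "norm (y - (f - e)) \<le> g2" "norm (y + e) \<le> g3"
    using assms(4) unfolding served_by_pair_def by blast
  then show "2 * omega0 + W0 \<le> g1 + g2 + g3"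
    and "g1 + g2 + g3 \<le> 2 * omega0 + W0 \<Longrightarrow>
           {t0 *\<^sub>R e, t0 *\<^sub>R f} \<subseteq> K \<and> g1 = omega0 \<and> g2 = omega0 \<and> g3 = W0"
    using pair_bound[OF assms(1-3) x y] by auto
qed

lemma min_value_less_3: "2 * omega0 + W0 < 3"
  using min_value_bounds unfolding abs_le_iff by simp

text \<open>The value \<open>3\<close>, below which \<open>served_by_pair_cases\<close> applies, exceeds the bound, so the estimate
  for pairs of triangles decides the minimum. In the equality case the three alternatives are the
  three complementary pairs. The location of \<open>K\<close> is recorded for the first pair only, because the
  other two Steiner classes are obtained by rotation.\<close>
lemma steiner_sum_bound:
  assumes hex: "hexagonal A e f" and K: "K \<in> compacts"
    and g: "\<And>i. hausdorff_dist K (A i) = g i"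
  shows "2 * omega0 + W0 \<le> steiner_sum A K"
    and "steiner_sum A K \<le> 2 * omega0 + W0 \<Longrightarrow>
       ({t0 *\<^sub>R e, t0 *\<^sub>R f} \<subseteq> K \<and> g 1 = omega0 \<and> g 2 = omega0 \<and> g 3 = W0) \<or>
       (g 2 = omega0 \<and> g 3 = omega0 \<and> g 1 = W0) \<or>
       (g 3 = omega0 \<and> g 1 = omega0 \<and> g 2 = W0)"
proof -
  have S: "steiner_sum A K = g 1 + g 2 + g 3" by (simp add: steiner_sum_expand g)
  have hexes: "hexagonal A e f" "hexagonal (\<lambda>i. A (i + 1)) (f - e) (- e)"
    "hexagonal (\<lambda>i. A (i + 1 + 1)) (- e - (f - e)) (- (f - e))"
    using hexagonal_shift[OF hex] hexagonal_shift[OF hexagonal_shift[OF hex]] hex by simp_all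
  have n: "norm e = 1" "norm f = 1" "e \<bullet> f = 1 / 2"
     "norm (f - e) = 1" "norm (- e) = 1" "(f - e) \<bullet> (- e) = 1 / 2"
     "norm (- f) = 1" "norm (e - f) = 1" "(- f) \<bullet> (e - f) = 1 / 2"
    using hexes unfolding hexagonal_def by (simp_all add: algebra_simps)
  note bounds = served_by_pair_bound[OF n(1-3), of K "g 1" "g 2" "g 3"]
    served_by_pair_bound[OF n(4-6), of K "g 2" "g 3" "g 1"]
    served_by_pair_bound[OF n(7-9), of K "g 3" "g 1" "g 2"]
  show "2 * omega0 + W0 \<le> steiner_sum A K"
  proof (cases "g 1 + g 2 + g 3 < 3")
    case True
    from served_by_pair_cases[OF hex K g True] show ?thesis
      unfolding S using bounds by linarith
  next
    case False
    with min_value_less_3 show ?thesis unfolding S by simp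
  qed
  assume le: "steiner_sum A K \<le> 2 * omega0 + W0"
  then have "g 1 + g 2 + g 3 < 3" using min_value_less_3 unfolding S by simp
  from served_by_pair_cases[OF hex K g this] show
      "({t0 *\<^sub>R e, t0 *\<^sub>R f} \<subseteq> K \<and> g 1 = omega0 \<and> g 2 = omega0 \<and> g 3 = W0) \<or>
       (g 2 = omega0 \<and> g 3 = omega0 \<and> g 1 = W0) \<or>
       (g 3 = omega0 \<and> g 1 = omega0 \<and> g 2 = W0)"
    using bounds(2,4,6) le unfolding S by (auto simp: add_ac)
qed

text \<open>Points with equal distances to \<open>e - f\<close> and \<open>f\<close> lie on the line spanned by \<open>e\<close>; on it the two
  circles meet at the parameters \<open>t\<close> and \<open>1 - t\<close>, of which \<open>t\<close> is the smaller.\<close>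
lemma closest_meet_hexagon:
  assumes n: "norm e = 1" "norm f = 1" "e \<bullet> f = 1 / 2" and t: "0 < t" "t < 1 / 2"
  shows "closest_meet (e - f) f (omega t) = t *\<^sub>R e"
proof -
  let ?S = "sphere (e - f) (omega t) \<inter> sphere f (omega t)"
  have mem: "t *\<^sub>R e \<in> ?S"
    using hexagon_dist[OF n, of t] by (simp add: dist_norm norm_minus_commute)
  have char: "x = t *\<^sub>R e \<or> x = (1 - t) *\<^sub>R e" if "x \<in> ?S" for x
  proof -
    have e: "(Re e)\<^sup>2 + (Im e)\<^sup>2 = 1" and f: "(Re f)\<^sup>2 + (Im f)\<^sup>2 = 1"
      and ef: "Re e * Re f + Im e * Im f = 1 / 2"
      using n by (simp_all add: norm_complex_def inner_complex_def)
    have ed: "norm (x - (e - f)) = norm (x - f)" "norm (x - f) = omega t"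
      using that by (simp_all add: dist_norm norm_minus_commute)
    have "x \<bullet> (e - 2 *\<^sub>R f) = 0"
    proof -
      have "(norm (x - (e - f)))\<^sup>2 = (norm (x - f))\<^sup>2" using ed by simp
      moreover have "e \<bullet> e = 1" "f \<bullet> f = 1" using n by (simp_all add: norm_eq_1)
      ultimately show ?thesis using n(3)
        by (simp add: power2_norm_eq_inner inner_diff inner_commute algebra_simps)
    qed
    then have x0: "Re x * (Re e - 2 * Re f) + Im x * (Im e - 2 * Im f) = 0"
      by (simp add: inner_complex_def)
    define s where "s = Re x * Re e + Im x * Im e"
    have x: "x = s *\<^sub>R e"
    proof (rule complex_eqI)
      show "Re x = Re (s *\<^sub>R e)" "Im x = Im (s *\<^sub>R e)"
        unfolding s_def using x0 e f ef by (simp, algebra)+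
    qed
    have "omega s = omega t" using hexagon_dist(2)[OF n, of s] ed x by simp
    then have "(s - t) * (s + t - 1) = 0"
      unfolding omega_def by (simp add: power2_eq_square algebra_simps)
    then have "s = t \<or> s = 1 - t" by auto
    then show ?thesis using x by auto
  qed
  have "is_arg_min norm (\<lambda>x. x \<in> ?S) x \<longleftrightarrow> x = t *\<^sub>R e" for x
  proof
    assume "is_arg_min norm (\<lambda>x. x \<in> ?S) x"
    then have "x \<in> ?S" "norm x \<le> norm (t *\<^sub>R e)"
      using mem unfolding is_arg_min_linorder by auto
    with char[of x] t n show "x = t *\<^sub>R e" by auto
  next
    assume "x = t *\<^sub>R e"
    then show "is_arg_min norm (\<lambda>x. x \<in> ?S) x"
      using mem char t n unfolding is_arg_min_linorder by fastforce
  qed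
  then show ?thesis
    unfolding closest_meet_def arg_min_on_def arg_min_def by (intro some_equality) blast+
qed

section \<open>The boundary is a regular hexagon\<close>

lemma cos_eq_cases:
  assumes "0 < x" "x < 2 * pi" "0 \<le> y" "y \<le> pi" "cos x = cos y"
  shows "x = y \<or> x = 2 * pi - y"
proof (cases "x \<le> pi")
  case True
  with assms cos_inj_pi[of x y] show ?thesis by simp
next
  case False
  moreover have "cos (2 * pi - x) = cos y" using assms(5) by (simp add: cos_diff)
  ultimately show ?thesis using assms cos_inj_pi[of "2 * pi - x" y] by simp
qed

lemma cos_sixth_turn:
  assumes "\<psi> \<in> {pi / 3, - pi / 3}"
  shows "cos \<psi> = 1 / 2"
proof -
  have "\<psi> = pi / 3 \<or> \<psi> = - (pi / 3)" using assms by simp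
  then show ?thesis by (elim disjE) (simp_all only: cos_minus cos_60)
qed

text \<open>The three vectors lie in a plane, so their Gram determinant \<open>(1 - c)\<^sup>2 (1 + 2 c)\<close> vanishes, where
  \<open>c\<close> is the common inner product; and \<open>c \<noteq> 1\<close> for distinct vectors.\<close>
lemma regular_triangle_inner:
  fixes p q r :: complex
  assumes n: "norm p = 1" "norm q = 1" "norm r = 1" and "p \<noteq> q"
    and l: "dist p q = l" "dist p r = l" "dist q r = l"
  shows "p \<bullet> q = - 1 / 2" "q \<bullet> r = - 1 / 2"
proof -
  have inner_dist: "x \<bullet> y = 1 - (dist x y)\<^sup>2 / 2" if "norm x = 1" "norm y = 1" for x y :: complex
    using that by (simp add: dist_norm power2_norm_eq_inner inner_diff inner_commute norm_eq_1 field_simps)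
  define c where "c = 1 - l\<^sup>2 / 2"
  have c: "p \<bullet> q = c" "p \<bullet> r = c" "q \<bullet> r = c"
    using n l by (simp_all add: inner_dist c_def)
  have "(Re p)\<^sup>2 + (Im p)\<^sup>2 = 1" "(Re q)\<^sup>2 + (Im q)\<^sup>2 = 1" "(Re r)\<^sup>2 + (Im r)\<^sup>2 = 1"
    "Re p * Re q + Im p * Im q = c" "Re p * Re r + Im p * Im r = c" "Re q * Re r + Im q * Im r = c"
    using n c by (simp_all add: norm_complex_def inner_complex_def)
  then have "(1 - c)\<^sup>2 * (1 + 2 * c) = 0" by algebra
  moreover have "c \<noteq> 1" using \<open>p \<noteq> q\<close> l(1) by (auto simp: c_def)
  ultimately have "c = - 1 / 2" by auto
  with c show "p \<bullet> q = - 1 / 2" "q \<bullet> r = - 1 / 2" by simp_all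
qed

text \<open>Let the points have angles \<open>x1 < y1 < x2 < y2 < x3 < y3 < x1 + 2 * pi\<close>. The inner products leave
  \<open>2 * pi / 3\<close> and \<open>4 * pi / 3\<close> for the two gaps \<open>x2 - x1\<close> and \<open>x3 - x2\<close>, and their sum is less than
  \<open>2 * pi\<close>, so both are \<open>2 * pi / 3\<close>. The gap \<open>y1 - x1\<close> is \<open>pi / 3\<close> or \<open>5 * pi / 3\<close>, and the latter would
  carry \<open>b 1\<close> past \<open>a 2\<close>. The sign of \<open>\<psi>\<close> is the orientation of the cyclic order.\<close>
lemma boundary_config_angle:
  assumes "boundary_config a b"
  obtains \<psi> u where "\<psi> \<in> {pi / 3, - pi / 3}" "norm u = 1"
    "a 1 = u" "a 2 = cis (2 * \<psi>) * u" "a 3 = cis (4 * \<psi>) * u" "\<And>i. b i = cis \<psi> * a i"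
proof -
  from assms obtain \<phi> where tri: "inscribed_regular_triangle a"
    and \<phi>: "\<phi> \<in> {pi / 3, - pi / 3}" and b: "\<And>i. b i = cis \<phi> * a i"
    and cyclic: "in_cyclic_order [a 1, b 1, a 2, b 2, a 3, b 3]"
    unfolding boundary_config_def rot_def by blast
  from cyclic obtain s :: real and \<theta>s where s: "s \<in> {1, -1}" and sorted: "sorted_wrt (<) \<theta>s"
    and less: "last \<theta>s < hd \<theta>s + 2 * pi"
    and map: "[a 1, b 1, a 2, b 2, a 3, b 3] = map (\<lambda>\<theta>. cis (s * \<theta>)) \<theta>s"
    unfolding in_cyclic_order_def by (elim bexE exE conjE) (rule that)
  from map obtain x1 y1 x2 y2 x3 y3 where \<theta>s: "\<theta>s = [x1, y1, x2, y2, x3, y3]"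
    by (auto simp: Cons_eq_map_conv)
  have val: "a 1 = cis (s * x1)" "b 1 = cis (s * y1)" "a 2 = cis (s * x2)" "a 3 = cis (s * x3)"
    using map unfolding \<theta>s by simp_all
  have ord: "x1 < y1" "y1 < x2" "x2 < x3" "x3 < x1 + 2 * pi"
    using sorted less unfolding \<theta>s by auto
  have cos_s: "cos (s * x) = cos x" for x using s by auto
  have inner_cis: "cis (s * x) \<bullet> cis (s * y) = cos (y - x)" for x y
    using cos_s[of "y - x"] by (simp add: inner_complex_def cos_diff right_diff_distrib mult.commute)
  have "inj a" "\<And>i. norm (a i) = 1" and "\<exists>l. \<forall>i j. i \<noteq> j \<longrightarrow> dist (a i) (a j) = l"
    using tri unfolding inscribed_regular_triangle_def by auto
  then obtain l where l: "\<And>i j. i \<noteq> j \<Longrightarrow> dist (a i) (a j) = l" by blast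
  have "dist (a 1) (a 2) = l" "dist (a 1) (a 3) = l" "dist (a 2) (a 3) = l" by (rule l; simp)+
  moreover have "a 1 \<noteq> a 2" using \<open>inj a\<close> by (auto dest: injD)
  ultimately have "a 1 \<bullet> a 2 = - 1 / 2" "a 2 \<bullet> a 3 = - 1 / 2"
    using regular_triangle_inner[of "a 1" "a 2" "a 3"] \<open>\<And>i. norm (a i) = 1\<close> by blast+
  then have "cos (x2 - x1) = cos (2 * pi / 3)" "cos (x3 - x2) = cos (2 * pi / 3)"
    using val inner_cis cos_120 by simp_all
  then have "x2 - x1 = 2 * pi / 3 \<or> x2 - x1 = 2 * pi - 2 * pi / 3"
    and "x3 - x2 = 2 * pi / 3 \<or> x3 - x2 = 2 * pi - 2 * pi / 3"
    using ord by (intro cos_eq_cases; simp)+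
  then have x: "x2 = x1 + 2 * pi / 3" "x3 = x1 + 4 * pi / 3" using ord by auto
  have "cis (s * y1) = cis (\<phi> + s * x1)" using b[of 1] val by (simp add: cis_mult)
  then have "cis (s * (y1 - x1)) = cis \<phi>"
    by (metis add_diff_cancel_right' cis_divide right_diff_distrib)
  then have "cos (s * (y1 - x1)) = cos \<phi>" by (metis cis.sel(1))
  then have "cos (y1 - x1) = cos (pi / 3)" using cos_sixth_turn[OF \<phi>] cos_s cos_60 by simp
  then have "y1 - x1 = pi / 3 \<or> y1 - x1 = 2 * pi - pi / 3"
    using ord by (intro cos_eq_cases; simp)
  then have y: "y1 = x1 + pi / 3" using ord x by auto
  show thesis
  proof (rule that[of "s * (pi / 3)" "a 1"])
    show "s * (pi / 3) \<in> {pi / 3, - pi / 3}" using s by auto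
    show "norm (a 1) = 1" by fact
    show "a 2 = cis (2 * (s * (pi / 3))) * a 1" "a 3 = cis (4 * (s * (pi / 3))) * a 1"
      using val x by (simp_all add: cis_mult algebra_simps)
    have "cis (s * (pi / 3)) * a 1 = cis \<phi> * a 1"
      using b[of 1] val y by (simp add: cis_mult algebra_simps)
    then have "cis (s * (pi / 3)) = cis \<phi>" using val by simp
    with b show "b i = cis (s * (pi / 3)) * a i" for i by simp
  qed simp
qed

text \<open>All relations between the vertices follow from \<open>w\<^sup>2 = w - 1\<close> for the primitive sixth root of
  unity \<open>w = cis \<psi>\<close>.\<close>
lemma boundary_config_hexagonal:
  assumes config: "boundary_config a b" and A: "\<And>i. A i = {a i, b i}"
  obtains \<psi> where "\<psi> \<in> {pi / 3, - pi / 3}" "hexagonal A (b 1) (a 2)"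
    "a 1 = b 1 - a 2" "b 2 = a 2 - b 1" "\<And>i. rot (2 * \<psi>) ` A i = A (i + 1)"
proof -
  obtain \<psi> u where \<psi>: "\<psi> \<in> {pi / 3, - pi / 3}" and u: "norm u = 1"
    and a: "a 1 = u" "a 2 = cis (2 * \<psi>) * u" "a 3 = cis (4 * \<psi>) * u" and b: "\<And>i. b i = cis \<psi> * a i"
    using boundary_config_angle[OF config] by blast
  define w where "w = cis \<psi>"
  note cos = cos_sixth_turn[OF \<psi>]
  have "sin \<psi> * sin \<psi> = 3 / 4"
    using sin_squared_eq[of \<psi>] unfolding cos by (simp add: power2_eq_square)
  then have w2: "w\<^sup>2 = w - 1"
    unfolding w_def by (intro complex_eqI) (simp_all add: power2_eq_square cos)
  have pw: "cis (2 * \<psi>) = w\<^sup>2" "cis (4 * \<psi>) = w ^ 4" by (simp_all add: w_def Complex.DeMoivre mult.commute)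
  have w3: "w ^ 3 = - 1" using w2 by algebra
  have w4: "w ^ 4 = - w" using w3 by algebra
  have eqs: "a 1 = b 1 - a 2" "b 2 = a 2 - b 1" "a 3 = - b 1" "b 3 = - a 2"
    using w2 w3 w4 unfolding b a pw w_def[symmetric] by (simp_all, algebra+)
  have "Re w = 1 / 2" by (simp add: w_def cos)
  have "b 1 \<bullet> a 2 = 1 / 2"
  proof -
    have e: "a 2 = w * b 1" unfolding b a pw w_def[symmetric] by (simp add: power2_eq_square)
    have "norm (b 1) = 1" unfolding b a using u by (simp add: norm_mult)
    then have "(Re (b 1))\<^sup>2 + (Im (b 1))\<^sup>2 = 1" by (simp add: norm_complex_def)
    then show ?thesis unfolding e inner_complex_def using \<open>Re w = 1 / 2\<close> by (simp, algebra)
  qed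
  moreover have "norm (b 1) = 1" "norm (a 2) = 1"
    unfolding b a using u by (simp_all add: norm_mult)
  ultimately have hex: "hexagonal A (b 1) (a 2)"
    unfolding hexagonal_def A using eqs by auto
  have "rot (2 * \<psi>) (a i) = a (i + 1)" for i
  proof -
    have "i = 1 \<or> i = 2 \<or> i = 3" by (rule exhaust_3)
    moreover have "w\<^sup>2 * (w ^ 4 * u) = u" using w2 by algebra
    moreover have "w\<^sup>2 * (w\<^sup>2 * u) = w ^ 4 * u" by algebra
    ultimately show ?thesis using a unfolding rot_def pw by (auto simp only: index_succ)
  qed
  moreover from this have "rot (2 * \<psi>) (b i) = b (i + 1)" for i
    unfolding b rot_def by (metis mult.left_commute)
  ultimately have "rot (2 * \<psi>) ` A i = A (i + 1)" for i unfolding A by simp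
  with \<psi> hex eqs(1,2) show thesis by (rule that)
qed

section \<open>Description of the Steiner classes\<close>

lemma dvec_nth: "dvec $ 1 = omega0" "dvec $ 2 = omega0" "dvec $ 3 = W0"
  by (simp_all add: dvec_def W0_def)

lemma steiner_pair_near:
  assumes hex: "hexagonal A e f"
  shows "\<And>x. x \<in> {t0 *\<^sub>R e, t0 *\<^sub>R f} \<Longrightarrow> \<exists>p\<in>A i. dist x p \<le> dvec $ i"
    and "\<And>p. p \<in> A i \<Longrightarrow> \<exists>x\<in>{t0 *\<^sub>R e, t0 *\<^sub>R f}. dist x p \<le> dvec $ i"
proof -
  have n: "norm e = 1" "norm f = 1" "e \<bullet> f = 1 / 2" "f \<bullet> e = 1 / 2"
    and A: "A 1 = {e - f, e}" "A 2 = {f, f - e}" "A 3 = {- e, - f}"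
    using hex unfolding hexagonal_def by (auto simp: inner_commute)
  have d: "dist (t0 *\<^sub>R e) (e - f) = omega0" "dist (t0 *\<^sub>R e) f = omega0" "dist (t0 *\<^sub>R e) (- f) = W0"
     "dist (t0 *\<^sub>R f) (f - e) = omega0" "dist (t0 *\<^sub>R f) e = omega0" "dist (t0 *\<^sub>R f) (- e) = W0"
    using hexagon_dist[OF n(1-3), of t0] hexagon_dist[OF n(2,1,4), of t0]
    by (simp_all add: dist_norm omega_def omega0_def W0_def)
  have "i = 1 \<or> i = 2 \<or> i = 3" by (rule exhaust_3)
  then show "\<And>x. x \<in> {t0 *\<^sub>R e, t0 *\<^sub>R f} \<Longrightarrow> \<exists>p\<in>A i. dist x p \<le> dvec $ i"
    and "\<And>p. p \<in> A i \<Longrightarrow> \<exists>x\<in>{t0 *\<^sub>R e, t0 *\<^sub>R f}. dist x p \<le> dvec $ i"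
    using d by (auto simp: A dvec_nth)
qed

lemma K_set_iff:
  assumes "hexagonal A e f"
  shows "x \<in> K_set A g \<longleftrightarrow> (\<forall>i. \<exists>p\<in>A i. dist x p \<le> g $ i)"
  by (simp add: K_set_def closed_nbhd_def infdist_le_iff[OF hexagonal_compacts[OF assms]])

lemma compact_K_set:
  assumes "hexagonal A e f"
  shows "compact (K_set A g)"
proof -
  have "closed (K_set A g)"
    unfolding K_set_def closed_nbhd_def
    by (intro closed_INT ballI closed_Collect_le continuous_intros)
  moreover have "bounded (K_set A g)"
  proof -
    have "bounded (\<Union>p\<in>A 1. cball p (g $ 1))"
      using assms by (auto simp: hexagonal_def)
    moreover have "K_set A g \<subseteq> (\<Union>p\<in>A 1. cball p (g $ 1))"
      using K_set_iff[OF assms] by (auto simp: dist_commute)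
    ultimately show ?thesis by (rule bounded_subset)
  qed
  ultimately show ?thesis by (simp add: compact_eq_bounded_closed)
qed

text \<open>Each distance is at most the component of \<open>dvec\<close>, because \<open>K\<close> is squeezed between a set that
  reaches every vertex and the set of all admissible points. The components add up to the lower
  bound for the sum of distances, so no distance can be smaller.\<close>
lemma between_imp_dist:
  assumes hex: "hexagonal A e f" and K: "K \<in> compacts"
    and "{t0 *\<^sub>R e, t0 *\<^sub>R f} \<subseteq> K" "K \<subseteq> K_set A dvec"
  shows "hausdorff_dist K (A i) = dvec $ i" and "steiner_sum A K = 2 * omega0 + W0"
proof -
  have le: "hausdorff_dist K (A i) \<le> dvec $ i" for i
    unfolding hausdorff_dist_le_iff[OF K hexagonal_compacts[OF hex]]
    using assms(3,4) K_set_iff[OF hex] steiner_pair_near(2)[OF hex, of _ i] by (meson subset_iff)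
  have lower: "2 * omega0 + W0 \<le> hausdorff_dist K (A 1) + hausdorff_dist K (A 2) + hausdorff_dist K (A 3)"
    using steiner_sum_bound(1)[OF hex K refl] unfolding steiner_sum_expand .
  with le[of 1] le[of 2] le[of 3] show "steiner_sum A K = 2 * omega0 + W0"
    unfolding steiner_sum_expand dvec_nth by linarith
  have "hausdorff_dist K (A 1) = dvec $ 1" "hausdorff_dist K (A 2) = dvec $ 2" "hausdorff_dist K (A 3) = dvec $ 3"
    using lower le[of 1] le[of 2] le[of 3] unfolding dvec_nth by linarith+
  with exhaust_3[of i] show "hausdorff_dist K (A i) = dvec $ i" by auto
qed

lemma steiner_pair_between:
  assumes "hexagonal A e f"
  shows "{t0 *\<^sub>R e, t0 *\<^sub>R f} \<in> compacts" "{t0 *\<^sub>R e, t0 *\<^sub>R f} \<subseteq> K_set A dvec"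
  using K_set_iff[OF assms] steiner_pair_near(1)[OF assms] by (auto simp: compacts_def)

lemma steiner_compacts_iff:
  assumes hex: "hexagonal A e f"
  shows "K \<in> steiner_compacts A \<longleftrightarrow> K \<in> compacts \<and> steiner_sum A K = 2 * omega0 + W0"
proof -
  let ?T = "{t0 *\<^sub>R e, t0 *\<^sub>R f}"
  have T: "steiner_sum A ?T = 2 * omega0 + W0"
    using between_imp_dist(2)[OF hex _ order_refl] steiner_pair_between[OF hex] by blast
  have lower: "2 * omega0 + W0 \<le> steiner_sum A L" if "L \<in> compacts" for L
    using steiner_sum_bound(1)[OF hex that refl] .
  show ?thesis
  proof
    assume "K \<in> steiner_compacts A"
    then have "K \<in> compacts" "steiner_sum A K \<le> steiner_sum A ?T"
      using steiner_pair_between(1)[OF hex] unfolding steiner_compacts_def by blast+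
    with lower[of K] T show "K \<in> compacts \<and> steiner_sum A K = 2 * omega0 + W0" by simp
  next
    assume "K \<in> compacts \<and> steiner_sum A K = 2 * omega0 + W0"
    with lower show "K \<in> steiner_compacts A" unfolding steiner_compacts_def by simp
  qed
qed

text \<open>This interval of sets has a least and a greatest element that belong to the class, which is why
  they are its only minimal and maximal elements.\<close>
lemma steiner_class_dvec_iff:
  assumes hex: "hexagonal A e f"
  shows "K \<in> steiner_class A dvec \<longleftrightarrow>
    K \<in> compacts \<and> {t0 *\<^sub>R e, t0 *\<^sub>R f} \<subseteq> K \<and> K \<subseteq> K_set A dvec"
proof
  assume "K \<in> steiner_class A dvec"
  then have K: "K \<in> compacts" and S: "steiner_sum A K = 2 * omega0 + W0"
    and d: "hausdorff_dist K (A i) = dvec $ i" for i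
    unfolding steiner_class_def steiner_compacts_iff[OF hex] by auto
  have "{t0 *\<^sub>R e, t0 *\<^sub>R f} \<subseteq> K"
    using steiner_sum_bound(2)[OF hex K d] S omega0_less_W0 unfolding dvec_nth by auto
  moreover have "K \<subseteq> K_set A dvec"
    using hausdorff_dist_le_iff[OF K hexagonal_compacts[OF hex]] d
    unfolding K_set_iff[OF hex] subset_iff by (metis order_refl)
  ultimately show "K \<in> compacts \<and> {t0 *\<^sub>R e, t0 *\<^sub>R f} \<subseteq> K \<and> K \<subseteq> K_set A dvec"
    using K by blast
next
  assume "K \<in> compacts \<and> {t0 *\<^sub>R e, t0 *\<^sub>R f} \<subseteq> K \<and> K \<subseteq> K_set A dvec"
  then show "K \<in> steiner_class A dvec"
    using between_imp_dist[OF hex] unfolding steiner_class_def steiner_compacts_iff[OF hex] by blast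
qed

lemma steiner_class_values:
  assumes hex: "hexagonal A e f" and "K \<in> steiner_class A g"
  shows "g \<in> {dvec, cyc dvec, cyc (cyc dvec)}"
proof -
  have K: "K \<in> compacts" and S: "steiner_sum A K = 2 * omega0 + W0"
    and d: "hausdorff_dist K (A i) = g $ i" for i
    using assms(2) unfolding steiner_class_def steiner_compacts_iff[OF hex] by auto
  show ?thesis
    using steiner_sum_bound(2)[OF hex K d] S
    unfolding insert_iff vec_eq_iff forall_3 cyc_def by (auto simp: dvec_nth)
qed

text \<open>Isometries preserve Hausdorff distances, so one that permutes the boundary sets cyclically
  permutes the components of the vector of distances and preserves their sum. It is applied to the
  rotation about \<open>o\<close> by two steps of the hexagon.\<close>
lemma isometry_steiner_class:
  assumes hex: "hexagonal A e f" and iso: "\<And>x y. dist (h x) (h y) = dist x y"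
    and shift: "\<And>i. h ` A i = A (i + 1)" and g: "\<And>i. g' $ (i + 1) = g $ i"
    and K: "K \<in> steiner_class A g"
  shows "h ` K \<in> steiner_class A g'"
proof -
  have "continuous_on UNIV h"
    unfolding continuous_on_iff using iso by metis
  moreover have K': "K \<in> compacts" and S: "steiner_sum A K = 2 * omega0 + W0"
    and dK: "\<And>i. hausdorff_dist K (A i) = g $ i"
    using K unfolding steiner_class_def steiner_compacts_iff[OF hex] by auto
  ultimately have "h ` K \<in> compacts"
    unfolding compacts_def by (auto intro: compact_continuous_image continuous_on_subset)
  moreover have d: "hausdorff_dist (h ` K) (A (i + 1)) = g $ i" for i
    unfolding shift[symmetric] hausdorff_dist_image[OF iso] by (rule dK)
  moreover have "hausdorff_dist (h ` K) (A i) = g' $ i" for i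
    using d[of "i - 1"] g[of "i - 1"] by simp
  moreover have "steiner_sum A (h ` K) = steiner_sum A K"
    using d[of 1] d[of 2] d[of 3] unfolding steiner_sum_expand dK index_succ by simp
  ultimately show ?thesis
    unfolding steiner_class_def steiner_compacts_iff[OF hex] using S by auto
qed

lemma dist_rot: "dist (rot \<phi> x) (rot \<phi> y) = dist x y"
  by (simp add: rot_def dist_norm norm_mult flip: right_diff_distrib)

lemma rot_rot: "rot \<alpha> (rot \<beta> z) = rot (\<alpha> + \<beta>) z"
  by (simp add: rot_def cis_mult flip: mult.assoc)

lemma cyc_nth: "cyc g $ 1 = g $ 2" "cyc g $ 2 = g $ 3" "cyc g $ 3 = g $ 1"
  by (simp_all add: cyc_def)

lemma cyc_cube: "cyc (cyc (cyc g)) = g"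
  by (simp add: vec_eq_iff forall_3 cyc_nth)

text \<open>Both the rotation and the cyclic permutation have order three, so the inclusions given by the
  isometry close up to equalities.\<close>
lemma steiner_class_rot:
  assumes hex: "hexagonal A e f" and shift: "\<And>i. rot \<alpha> ` A i = A (i + 1)"
    and full: "rot (3 * \<alpha>) = id"
  shows "steiner_class A (cyc (cyc g)) = (`) (rot \<alpha>) ` steiner_class A g"
    and "steiner_class A (cyc g) = (`) (rot (2 * \<alpha>)) ` steiner_class A g"
proof -
  have up: "rot \<alpha> ` K \<in> steiner_class A (cyc (cyc h))" if "K \<in> steiner_class A h" for K h
  proof (rule isometry_steiner_class[OF hex dist_rot shift _ that])
    show "cyc (cyc h) $ (i + 1) = h $ i" for i
      using exhaust_3[of i] by (auto simp only: index_succ cyc_nth)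
  qed
  have up2: "rot (2 * \<alpha>) ` K \<in> steiner_class A (cyc h)" if "K \<in> steiner_class A h" for K h
    using up[OF up[OF that]] unfolding image_image rot_rot cyc_cube mult_2 .
  have inverse: "rot \<alpha> ` rot (2 * \<alpha>) ` K = K" "rot (2 * \<alpha>) ` rot \<alpha> ` K = K" for K
  proof -
    have turns: "\<alpha> + 2 * \<alpha> = 3 * \<alpha>" "2 * \<alpha> + \<alpha> = 3 * \<alpha>" by simp_all
    show "rot \<alpha> ` rot (2 * \<alpha>) ` K = K" "rot (2 * \<alpha>) ` rot \<alpha> ` K = K"
      unfolding image_image rot_rot turns full by simp_all
  qed
  show "steiner_class A (cyc (cyc g)) = (`) (rot \<alpha>) ` steiner_class A g"
  proof (intro equalityI subsetI)
    fix K assume "K \<in> steiner_class A (cyc (cyc g))"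
    from up2[OF this] have "rot (2 * \<alpha>) ` K \<in> steiner_class A g" unfolding cyc_cube .
    then show "K \<in> (`) (rot \<alpha>) ` steiner_class A g"
      by (intro image_eqI[where x = "rot (2 * \<alpha>) ` K"]) (simp_all only: inverse)
  qed (use up in blast)
  show "steiner_class A (cyc g) = (`) (rot (2 * \<alpha>)) ` steiner_class A g"
  proof (intro equalityI subsetI)
    fix K assume "K \<in> steiner_class A (cyc g)"
    from up[OF this] have "rot \<alpha> ` K \<in> steiner_class A g" unfolding cyc_cube .
    then show "K \<in> (`) (rot (2 * \<alpha>)) ` steiner_class A g"
      by (intro image_eqI[where x = "rot \<alpha> ` K"]) (simp_all only: inverse)
  qed (use up2 in blast)
qed

lemma rot_mod_2pi: "rot (\<alpha> + 2 * pi) = rot \<alpha>" "rot (\<alpha> - 2 * pi) = rot \<alpha>"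
  by (simp_all add: rot_def fun_eq_iff flip: cis_mult cis_divide)

lemma partition_on_fibres:
  "partition_on X {{x \<in> X. \<Phi> x = g} | g. {x \<in> X. \<Phi> x = g} \<noteq> {}}"
  by (rule partition_onI) (auto simp: disjnt_def)

lemma dvec_distinct: "distinct [dvec, cyc dvec, cyc (cyc dvec)]"
  using omega0_less_W0 by (auto simp: vec_eq_iff forall_3 cyc_nth dvec_nth)

lemma steiner_class_eq_imp_eq:
  assumes "steiner_class A g = steiner_class A h" "steiner_class A g \<noteq> {}"
  shows "g = h"
proof -
  obtain K where "K \<in> steiner_class A g" "K \<in> steiner_class A h" using assms by blast
  then show ?thesis unfolding steiner_class_def vec_eq_iff by simp
qed

theorem theorem2:
  fixes a b :: "3 \<Rightarrow> complex" and A :: "3 \<Rightarrow> complex set" and K0 :: "complex set"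
  assumes config: "boundary_config a b"
    and A: "\<And>i. A i = {a i, b i}"
    and K0: "K0 = T_ab a b t0"
  shows
    "(K0 \<in> steiner_compacts A \<and>
      hausdorff_dist K0 (A 1) = omega0 \<and>
      hausdorff_dist K0 (A 2) = omega0 \<and>
      hausdorff_dist K0 (A 3) = sqrt (1 + t0\<^sup>2 + t0) \<and>
      K0 \<in> steiner_class A dvec \<and>
      steiner_sum A K0 = 2 * omega0 + sqrt (1 + t0\<^sup>2 + t0) \<and>
      steiner_sum A K0 = sqrt (35 / 8 + 3 / 8 * sqrt (- 47 + 80 * sqrt 5)) \<and>
      \<bar>steiner_sum A K0 - 2.94645\<bar> \<le> 0.000005 \<and>
      steiner_sum A K0 < 3) \<and>
     (\<forall>K. minimal_in (steiner_class A dvec) K \<longleftrightarrow> K = K0) \<and>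
     (\<forall>K. maximal_in (steiner_class A dvec) K \<longleftrightarrow> K = K_set A dvec) \<and>
     (partition_on (steiner_compacts A) (steiner_classes A) \<and>
      card (steiner_classes A) = 3 \<and>
      distinct [dvec, cyc dvec, cyc (cyc dvec)] \<and>
      {g. steiner_class A g \<noteq> {}} = {dvec, cyc dvec, cyc (cyc dvec)} \<and>
      {steiner_class A (cyc dvec), steiner_class A (cyc (cyc dvec))} =
        {(`) (rot (2 * pi / 3)) ` steiner_class A dvec,
         (`) (rot (4 * pi / 3)) ` steiner_class A dvec})"
proof -
  let ?e = "b 1" and ?f = "a 2"
  obtain \<psi> where \<psi>: "\<psi> \<in> {pi / 3, - pi / 3}" and hex: "hexagonal A ?e ?f"
    and ab: "a 1 = ?e - ?f" "b 2 = ?f - ?e" and shift: "\<And>i. rot (2 * \<psi>) ` A i = A (i + 1)"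
    using boundary_config_hexagonal[OF config A] by blast
  have n: "norm ?e = 1" "norm ?f = 1" "?e \<bullet> ?f = 1 / 2" "?f \<bullet> ?e = 1 / 2"
    using hex unfolding hexagonal_def by (auto simp: inner_commute)
  have K0_pair: "K0 = {t0 *\<^sub>R ?e, t0 *\<^sub>R ?f}"
    using closest_meet_hexagon[OF n(1-3) t0_bounds] closest_meet_hexagon[OF n(2,1,4) t0_bounds]
    unfolding K0 T_ab_def ab by (simp add: closest_meet_def Int_commute)
  note class_iff = steiner_class_dvec_iff[OF hex, folded K0_pair]
  have K0_between: "K0 \<in> compacts" "K0 \<subseteq> K_set A dvec"
    using steiner_pair_between[OF hex] unfolding K0_pair by auto
  then have K0_class: "K0 \<in> steiner_class A dvec" unfolding class_iff by simp
  then have K0_steiner: "K0 \<in> steiner_compacts A" and K0_dist: "\<And>i. hausdorff_dist K0 (A i) = dvec $ i"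
    unfolding steiner_class_def by auto
  then have sum: "steiner_sum A K0 = 2 * omega0 + W0" using steiner_compacts_iff[OF hex] by blast
  have part1: "K0 \<in> steiner_compacts A \<and>
      hausdorff_dist K0 (A 1) = omega0 \<and>
      hausdorff_dist K0 (A 2) = omega0 \<and>
      hausdorff_dist K0 (A 3) = sqrt (1 + t0\<^sup>2 + t0) \<and>
      K0 \<in> steiner_class A dvec \<and>
      steiner_sum A K0 = 2 * omega0 + sqrt (1 + t0\<^sup>2 + t0) \<and>
      steiner_sum A K0 = sqrt (35 / 8 + 3 / 8 * sqrt (- 47 + 80 * sqrt 5)) \<and>
      \<bar>steiner_sum A K0 - 2.94645\<bar> \<le> 0.000005 \<and>
      steiner_sum A K0 < 3"
    unfolding sum W0_def[symmetric]
    using K0_steiner K0_class K0_dist min_value min_value_bounds min_value_less_3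
    by (auto simp only: dvec_nth)
  have least: "K0 \<subseteq> K" and greatest: "K \<subseteq> K_set A dvec" if "K \<in> steiner_class A dvec" for K
    using that class_iff by simp_all
  have part2: "\<forall>K. minimal_in (steiner_class A dvec) K \<longleftrightarrow> K = K0"
    unfolding minimal_in_def using K0_class least by (metis subset_antisym)
  have "K_set A dvec \<in> steiner_class A dvec"
    using K0_between compact_K_set[OF hex] unfolding class_iff by (auto simp: compacts_def)
  then have part3: "\<forall>K. maximal_in (steiner_class A dvec) K \<longleftrightarrow> K = K_set A dvec"
    unfolding maximal_in_def using greatest by (metis subset_antisym)
  have \<psi>': "\<psi> = pi / 3 \<or> \<psi> = - (pi / 3)" using \<psi> by simp
  have "rot 0 = id" by (simp add: rot_def fun_eq_iff)
  moreover have "3 * (2 * \<psi>) = 0 + 2 * pi \<or> 3 * (2 * \<psi>) = 0 - 2 * pi" using \<psi>' by auto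
  ultimately have "rot (3 * (2 * \<psi>)) = id" using rot_mod_2pi by metis
  note rotated = steiner_class_rot[OF hex shift this, of dvec]
  have "2 * \<psi> = 2 * pi / 3 \<and> 2 * (2 * \<psi>) = 4 * pi / 3 \<or>
        2 * \<psi> = 4 * pi / 3 - 2 * pi \<and> 2 * (2 * \<psi>) = 2 * pi / 3 - 2 * pi"
    using \<psi>' by auto
  then have "rot (2 * \<psi>) = rot (2 * pi / 3) \<and> rot (2 * (2 * \<psi>)) = rot (4 * pi / 3) \<or>
        rot (2 * \<psi>) = rot (4 * pi / 3) \<and> rot (2 * (2 * \<psi>)) = rot (2 * pi / 3)"
    by (elim disjE conjE) (simp_all only: rot_mod_2pi simp_thms)
  then have rotations: "{steiner_class A (cyc dvec), steiner_class A (cyc (cyc dvec))} =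
        {(`) (rot (2 * pi / 3)) ` steiner_class A dvec, (`) (rot (4 * pi / 3)) ` steiner_class A dvec}"
    unfolding rotated by (elim disjE conjE) (simp_all only: insert_commute simp_thms)
  have nonempty: "{g. steiner_class A g \<noteq> {}} = {dvec, cyc dvec, cyc (cyc dvec)}" (is "?G = _")
  proof
    show "?G \<subseteq> {dvec, cyc dvec, cyc (cyc dvec)}"
      using steiner_class_values[OF hex] by blast
    show "{dvec, cyc dvec, cyc (cyc dvec)} \<subseteq> ?G"
      using K0_class rotated by auto
  qed
  have classes: "steiner_classes A = steiner_class A ` ?G"
    unfolding steiner_classes_def by blast
  have "inj_on (steiner_class A) ?G"
    by (rule inj_onI) (use steiner_class_eq_imp_eq in blast)
  then have "card (steiner_classes A) = card ?G" unfolding classes by (rule card_image)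
  also have "\<dots> = 3" unfolding nonempty using distinct_card[OF dvec_distinct] by simp
  finally have card: "card (steiner_classes A) = 3" .
  have "steiner_class A g = {K \<in> steiner_compacts A. (\<chi> i. hausdorff_dist K (A i)) = g}" for g
    unfolding steiner_class_def by (simp add: vec_eq_iff)
  then have partition: "partition_on (steiner_compacts A) (steiner_classes A)"
    unfolding steiner_classes_def
    using partition_on_fibres[of "steiner_compacts A" "\<lambda>K. \<chi> i. hausdorff_dist K (A i)"] by simp
  show ?thesis
    by (rule conjI[OF part1 conjI[OF part2 conjI[OF part3 conjI[OF partition
          conjI[OF card conjI[OF dvec_distinct conjI[OF nonempty rotations]]]]]]])
qed

end
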